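(* Let $T:\mathbf F(\Sigma_{\mathbf{LFI}},\mathcal V)\to\mathbf F(\Sigma_{\mathbf{nbI}},\mathcal V)$ be the map defined by $T(p)=p$ for $p\in\mathcal V$, $T(\neg\alpha)=\neg T(\alpha)$, $T(\alpha\#\beta)=T(\alpha)\#T(\beta)$ for $\#\in\{\vee,\wedge,\to\}$, and $T(\circ\alpha)=T(\alpha)\uparrow\neg T(\alpha)$. Then for every $\mathcal L\in\{\mathbf{mbC},\mathbf{mbCciw},\mathbf{mbCci},\mathbf{mbCcl}\}$ and every set of formulas $\Gamma\cup\{\varphi\}\subseteq\mathbf F(\Sigma_{\mathbf{LFI}},\mathcal V)$: $\Gamma\vdash_{\mathcal L}\varphi$ if and only if $T(\Gamma)\vdash_{\mathcal L^*}T(\varphi)$. (That is, $T$ is a conservative translation from $\mathcal L$ to $\mathcal L^*$.)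
   Context: Let $\mathcal V$ be a countable set of propositional variables; $\Sigma_{\mathbf{LFI}}=\{\vee,\wedge,\to,\neg,\circ\}$ with $\neg,\circ$ unary and the others binary; $\Sigma_{\mathbf{nbI}}=\{\vee,\wedge,\to,\uparrow,\neg\}$ with $\neg$ unary and the others binary. $\mathbf F(\Sigma,\mathcal V)$ is the set of formulas over $\Sigma$. The logic $\mathbf{mbC}$ is the Hilbert calculus over $\Sigma_{\mathbf{LFI}}$ with Modus Ponens as only rule and axiom schemata: (1) $\alpha\to(\beta\to\alpha)$; (2) $(\alpha\to(\beta\to\gamma))\to((\alpha\to\beta)\to(\alpha\to\gamma))$; (3) $\alpha\to(\beta\to(\alpha\wedge\beta))$; (4) $(\alpha\wedge\beta)\to\alpha$; (5) $(\alpha\wedge\beta)\to\beta$; (6) $\alpha\to(\alpha\vee\beta)$; (7) $\beta\to(\alpha\vee\beta)$; (8) $(\alpha\to\gamma)\to((\beta\to\gamma)\to((\alpha\vee\beta)\to\gamma))$; (9) $(\alpha\to\beta)\vee\alpha$; (10) $\alpha\vee\neg\alpha$; (bc1) $\circ\alpha\to(\alpha\to(\neg\alpha\to\beta))$. The logics $\mathbf{mbCciw}$, $\mathbf{mbCci}$, $\mathbf{mbCcl}$ are obtained from $\mathbf{mbC}$ by adding, respectively, the schema $\circ\alpha\vee(\alpha\wedge\neg\alpha)$; $\neg{\circ}\alpha\to(\alpha\wedge\neg\alpha)$; $\neg(\alpha\wedge\neg\alpha)\to\circ\alpha$. For a logic $\mathcal L$ over $\Sigma_{\mathbf{LFI}}$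 with axiom schemata $\Psi$ and Modus Ponens as only rule, $\mathcal L^*$ is the Hilbert calculus over $\Sigma_{\mathbf{nbI}}$ with axiom schemata $T(\Psi)$ (i.e. each occurrence of a subformula $\circ\alpha$ in a schema is replaced by $\alpha\uparrow\neg\alpha$, and the resulting schemata are instantiated by arbitrary formulas of $\mathbf F(\Sigma_{\mathbf{nbI}},\mathcal V)$) and Modus Ponens as only rule. $\vdash$ denotes derivability from premises, and $T(\Gamma)=\{T(\gamma):\gamma\in\Gamma\}$. *)

theory Defs
  imports "HOL-Library.Countable"
begin

datatype 'v lfi =
    LVar 'v
  | LNeg "'v lfi"  ("\<not>\<^sub>L _" [90] 90)
  | LCirc "'v lfi"  ("\<circ>\<^sub>L _" [90] 90)
  | LAnd "'v lfi" "'v lfi"  (infixr "\<and>\<^sub>L" 80)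
  | LOr "'v lfi" "'v lfi"  (infixr "\<or>\<^sub>L" 75)
  | LImp "'v lfi" "'v lfi"  (infixr "\<rightarrow>\<^sub>L" 70)

datatype 'v nbi =
    NVar 'v
  | NNeg "'v nbi"  ("\<not>\<^sub>N _" [90] 90)
  | NUp "'v nbi" "'v nbi"  (infixl "\<up>\<^sub>N" 85)
  | NAnd "'v nbi" "'v nbi"  (infixr "\<and>\<^sub>N" 80)
  | NOr "'v nbi" "'v nbi"  (infixr "\<or>\<^sub>N" 75)
  | NImp "'v nbi" "'v nbi"  (infixr "\<rightarrow>\<^sub>N" 70)

text \<open>The map T is polymorphic in the type of variables, so that it applies both to formulas
  and to axiom schemata (formulas over metavariables, see below).\<close>

primrec T :: "'v lfi \<Rightarrow> 'v nbi" where
  "T (LVar p) = NVar p"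
| "T (\<not>\<^sub>L A) = \<not>\<^sub>N (T A)"
| "T (\<circ>\<^sub>L A) = T A \<up>\<^sub>N (\<not>\<^sub>N (T A))"
| "T (A \<and>\<^sub>L B) = T A \<and>\<^sub>N T B"
| "T (A \<or>\<^sub>L B) = T A \<or>\<^sub>N T B"
| "T (A \<rightarrow>\<^sub>L B) = T A \<rightarrow>\<^sub>N T B"

primrec lfi_subst :: "('m \<Rightarrow> 'v lfi) \<Rightarrow> 'm lfi \<Rightarrow> 'v lfi" where
  "lfi_subst s (LVar p) = s p"
| "lfi_subst s (\<not>\<^sub>L A) = \<not>\<^sub>L (lfi_subst s A)"
| "lfi_subst s (\<circ>\<^sub>L A) = \<circ>\<^sub>L (lfi_subst s A)"
| "lfi_subst s (A \<and>\<^sub>L B) = lfi_subst s A \<and>\<^sub>L lfi_subst s B"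
| "lfi_subst s (A \<or>\<^sub>L B) = lfi_subst s A \<or>\<^sub>L lfi_subst s B"
| "lfi_subst s (A \<rightarrow>\<^sub>L B) = lfi_subst s A \<rightarrow>\<^sub>L lfi_subst s B"

primrec nbi_subst :: "('m \<Rightarrow> 'v nbi) \<Rightarrow> 'm nbi \<Rightarrow> 'v nbi" where
  "nbi_subst s (NVar p) = s p"
| "nbi_subst s (\<not>\<^sub>N A) = \<not>\<^sub>N (nbi_subst s A)"
| "nbi_subst s (A \<up>\<^sub>N B) = nbi_subst s A \<up>\<^sub>N nbi_subst s B"
| "nbi_subst s (A \<and>\<^sub>N B) = nbi_subst s A \<and>\<^sub>N nbi_subst s B"
| "nbi_subst s (A \<or>\<^sub>N B) = nbi_subst s A \<or>\<^sub>N nbi_subst s B"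
| "nbi_subst s (A \<rightarrow>\<^sub>N B) = nbi_subst s A \<rightarrow>\<^sub>N nbi_subst s B"

text \<open>A set of schemata is a set of formulas over metavariables of type 'm; the axioms of the
  Hilbert calculus over the formulas in variables 'v are all substitution instances.\<close>

inductive lfi_derivable :: "'m lfi set \<Rightarrow> 'v lfi set \<Rightarrow> 'v lfi \<Rightarrow> bool"
  for \<Psi> :: "'m lfi set" and \<Gamma> :: "'v lfi set" where
  lfi_premise: "A \<in> \<Gamma> \<Longrightarrow> lfi_derivable \<Psi> \<Gamma> A"
| lfi_axiom: "P \<in> \<Psi> \<Longrightarrow> lfi_derivable \<Psi> \<Gamma> (lfi_subst s P)"
| lfi_mp: "lfi_derivable \<Psi> \<Gamma> A \<Longrightarrow> lfi_derivable \<Psi> \<Gamma> (A \<rightarrow>\<^sub>L B) \<Longrightarrow> lfi_derivable \<Psi> \<Gamma> B"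

inductive nbi_derivable :: "'m nbi set \<Rightarrow> 'v nbi set \<Rightarrow> 'v nbi \<Rightarrow> bool"
  for \<Psi> :: "'m nbi set" and \<Gamma> :: "'v nbi set" where
  nbi_premise: "A \<in> \<Gamma> \<Longrightarrow> nbi_derivable \<Psi> \<Gamma> A"
| nbi_axiom: "P \<in> \<Psi> \<Longrightarrow> nbi_derivable \<Psi> \<Gamma> (nbi_subst s P)"
| nbi_mp: "nbi_derivable \<Psi> \<Gamma> A \<Longrightarrow> nbi_derivable \<Psi> \<Gamma> (A \<rightarrow>\<^sub>N B) \<Longrightarrow> nbi_derivable \<Psi> \<Gamma> B"

datatype metavar = MA | MB | MC

abbreviation mA :: "metavar lfi" where "mA \<equiv> LVar MA"
abbreviation mB :: "metavar lfi" where "mB \<equiv> LVar MB"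
abbreviation mC :: "metavar lfi" where "mC \<equiv> LVar MC"

definition mbC :: "metavar lfi set" where
  "mbC = {
    mA \<rightarrow>\<^sub>L (mB \<rightarrow>\<^sub>L mA),
    (mA \<rightarrow>\<^sub>L (mB \<rightarrow>\<^sub>L mC)) \<rightarrow>\<^sub>L ((mA \<rightarrow>\<^sub>L mB) \<rightarrow>\<^sub>L (mA \<rightarrow>\<^sub>L mC)),
    mA \<rightarrow>\<^sub>L (mB \<rightarrow>\<^sub>L (mA \<and>\<^sub>L mB)),
    (mA \<and>\<^sub>L mB) \<rightarrow>\<^sub>L mA,
    (mA \<and>\<^sub>L mB) \<rightarrow>\<^sub>L mB,
    mA \<rightarrow>\<^sub>L (mA \<or>\<^sub>L mB),
    mB \<rightarrow>\<^sub>L (mA \<or>\<^sub>L mB),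
    (mA \<rightarrow>\<^sub>L mC) \<rightarrow>\<^sub>L ((mB \<rightarrow>\<^sub>L mC) \<rightarrow>\<^sub>L ((mA \<or>\<^sub>L mB) \<rightarrow>\<^sub>L mC)),
    (mA \<rightarrow>\<^sub>L mB) \<or>\<^sub>L mA,
    mA \<or>\<^sub>L (\<not>\<^sub>L mA),
    (\<circ>\<^sub>L mA) \<rightarrow>\<^sub>L (mA \<rightarrow>\<^sub>L ((\<not>\<^sub>L mA) \<rightarrow>\<^sub>L mB))}"

definition mbCciw :: "metavar lfi set" where
  "mbCciw = mbC \<union> {(\<circ>\<^sub>L mA) \<or>\<^sub>L (mA \<and>\<^sub>L (\<not>\<^sub>L mA))}"

definition mbCci :: "metavar lfi set" where
  "mbCci = mbC \<union> {(\<not>\<^sub>L (\<circ>\<^sub>L mA)) \<rightarrow>\<^sub>L (mA \<and>\<^sub>L (\<not>\<^sub>L mA))}"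

definition mbCcl :: "metavar lfi set" where
  "mbCcl = mbC \<union> {(\<not>\<^sub>L (mA \<and>\<^sub>L (\<not>\<^sub>L mA))) \<rightarrow>\<^sub>L (\<circ>\<^sub>L mA)}"

end

theory Submission
  imports Defs
begin

text \<open>Conservativity needs no semantics: a left inverse \<open>U\<close> of \<open>T\<close> carries derivations back line
  by line. It reads a formula of the shape \<open>A \<up>\<^sub>N (\<not>\<^sub>N A)\<close> as the consistency statement
  \<open>\<circ>\<^sub>L (U A)\<close>, even if \<open>A\<close> itself is not a translation. In the schemata \<open>T ` \<Psi>\<close> the connective
  \<open>\<up>\<^sub>N\<close> occurs only in this shape, and substituting arbitrary formulas preserves the shape. Hence
  \<open>U\<close> sends every instance of \<open>T P\<close> to an instance of \<open>P\<close> (lemma \<open>U_nbi_subst_T\<close>). Since \<open>U\<close>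
  also commutes with implication, Modus Ponens is preserved.\<close>

text \<open>If \<open>B \<noteq> \<not>\<^sub>N A\<close>, then \<open>A \<up>\<^sub>N B\<close> has no counterpart among the source formulas; \<open>U A\<close> is a
  default value.\<close>

primrec U :: "'v nbi \<Rightarrow> 'v lfi" where
  "U (NVar p) = LVar p"
| "U (\<not>\<^sub>N A) = \<not>\<^sub>L (U A)"
| "U (A \<up>\<^sub>N B) = (if B = \<not>\<^sub>N A then \<circ>\<^sub>L (U A) else U A)"
| "U (A \<and>\<^sub>N B) = U A \<and>\<^sub>L U B"
| "U (A \<or>\<^sub>N B) = U A \<or>\<^sub>L U B"
| "U (A \<rightarrow>\<^sub>N B) = U A \<rightarrow>\<^sub>L U B"

lemma U_T [simp]: "U (T A) = A"
  by (induction A) simp_all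

lemma T_lfi_subst: "T (lfi_subst s P) = nbi_subst (T \<circ> s) (T P)"
  by (induction P) simp_all

text \<open>The formulas \<open>s m\<close> need not lie in the range of \<open>T\<close>: both arguments of a \<open>\<up>\<^sub>N\<close> in \<open>T P\<close>
  are instantiated in parallel, so the test in the definition of \<open>U\<close> still succeeds there.\<close>

lemma U_nbi_subst_T: "U (nbi_subst s (T P)) = lfi_subst (U \<circ> s) P"
  by (induction P) simp_all

lemma nbi_derivable_T:
  assumes "lfi_derivable \<Psi> \<Gamma> A"
  shows "nbi_derivable (T ` \<Psi>) (T ` \<Gamma>) (T A)"
  using assms
proof induction
  case (lfi_premise A)
  then show ?case by (simp add: nbi_premise)
next
  case (lfi_axiom P s)
  then show ?case by (simp add: T_lfi_subst nbi_axiom)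
next
  case (lfi_mp A B)
  then show ?case by (auto intro: nbi_mp)
qed

lemma lfi_derivable_U:
  assumes "nbi_derivable (T ` \<Psi>) \<Delta> A"
  shows "lfi_derivable \<Psi> (U ` \<Delta>) (U A)"
  using assms
proof induction
  case (nbi_premise A)
  then show ?case by (simp add: lfi_premise)
next
  case (nbi_axiom P s)
  then show ?case by (auto simp: U_nbi_subst_T lfi_axiom)
next
  case (nbi_mp A B)
  then show ?case by (auto intro: lfi_mp)
qed

theorem mainTheorem15:
  fixes L :: "metavar lfi set"
    and \<Gamma> :: "('v :: countable) lfi set"
    and \<phi> :: "'v lfi"
  assumes "L \<in> {mbC, mbCciw, mbCci, mbCcl}"
  shows "lfi_derivable L \<Gamma> \<phi> \<longleftrightarrow> nbi_derivable (T ` L) (T ` \<Gamma>) (T \<phi>)"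
proof
  assume "lfi_derivable L \<Gamma> \<phi>"
  then show "nbi_derivable (T ` L) (T ` \<Gamma>) (T \<phi>)"
    by (rule nbi_derivable_T)
next
  assume "nbi_derivable (T ` L) (T ` \<Gamma>) (T \<phi>)"
  then have "lfi_derivable L (U ` T ` \<Gamma>) (U (T \<phi>))"
    by (rule lfi_derivable_U)
  then show "lfi_derivable L \<Gamma> \<phi>"
    by (simp add: image_image)
qed

end
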